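(* Let $\Omega\subset\mathbb{R}^3$ be a bounded sliceable domain with Lipschitz boundary $\Gamma$, and let $\emptyset\neq\Gamma_t\subset\Gamma$ be relatively open and separated from $\Gamma_n:=\Gamma\setminus\overline{\Gamma_t}$ by a Lipschitz curve. Let $c_m>0$ be a Maxwell constant and $c_k>0$ an irrotational Korn constant for $(\Omega,\Gamma_t)$ (defined in the context) and $\hat c:=\max\{\sqrt2\,c_k,\;c_m\sqrt{1+2c_k^2}\}$. Then: (i) $\|T\|_{L^2(\Omega)}\leq\hat c\,\|\mathrm{sym}\,T\|_{L^2(\Omega)}$ holds for all tensor fields $T\in\mathring H(\mathrm{Curl}_0;\Gamma_t,\Omega)$. (ii) $\|\mathrm{Grad}\,v\|_{L^2(\Omega)}\leq\hat c\,\|\mathrm{sym}\,\mathrm{Grad}\,v\|_{L^2(\Omega)}$ holds for all vector fields $v\in H(\mathrm{Grad};\Omega)$ with $\mathrm{Grad}\,v\in\mathring H(\mathrm{Curl}_0;\Gamma_t,\Omega)$. (iii) $\|\mathrm{Grad}\,v\|_{L^2(\Omega)}\leq\hat c\,\|\mathrm{sym}\,\mathrm{Grad}\,v\|_{L^2(\Omega)}$ holds for all vector fields $v\in\mathring H(\mathrm{Grad};\Gamma_t,\Omega)$.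
   Context: A domain is a nonempty connected open set. $L^2(\Omega)$ denotes square-integrable functions, vector fields or $3\times3$ tensor fields (with the Frobenius inner product), $\bot$ is the orthogonal complement in $L^2(\Omega)$. $\mathrm{sym}\,T=\frac12(T+T^\top)$. "$\Gamma_t$ and $\Gamma_n$ are separated by a Lipschitz curve" means that the common relative boundary of $\Gamma_t$ and $\Gamma_n$ in $\Gamma$ is empty or is, locally in bi-Lipschitz charts of $\Gamma$, a Lipschitz curve with $\Gamma_t$ on one side and $\Gamma_n$ on the other. For $\gamma\subset\Gamma$, $\mathring C^\infty(\gamma,\Omega):=\{u\in C^\infty(\overline\Omega):\mathrm{dist}(\mathrm{supp}\,u,\gamma)>0\}$ (all of $C^\infty(\overline\Omega)$ if $\gamma=\emptyset$). $\mathring H(\mathrm{curl};\Gamma_t,\Omega)$ and $\mathring H(\mathrm{div};\Gamma_n,\Omega)$ are the closures of the vector fields with components in $\mathring C^\infty(\Gamma_t,\Omega)$ resp. $\mathring C^\infty(\Gamma_n,\Omega)$ in the graph norms of $\mathrm{curl}$ resp. $\mathrm{div}$ in $L^2$. A lower index $0$ (as in $\mathrm{curl}_0$, $\mathrm{div}_0$) means additionally $\mathrm{curl}\,v=0$ resp. $\mathrm{div}\,v=0$. $\mathcal H(\Omega):=\mathring H(\mathrm{curl}_0;\Gamma_t,\Omega)\cap\mathring H(\mathrm{div}_0;\Gamma_n,\Omega)$. $\mathrm{Grad}\,v$ is the Jacobian of a vector field $v$ (rows are gradients of the components). $H(\mathrm{Grad};\Omega)=H^1(\Omega,\mathbb R^3)$,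 and $\mathring H(\mathrm{Grad};\Gamma_t,\Omega)$ is the closure in it of the vector fields with components in $\mathring C^\infty(\Gamma_t,\Omega)$. $\mathring H(\mathrm{Curl}_0;\Gamma_t,\Omega)$ is the space of $3\times3$ tensor fields all of whose rows lie in $\mathring H(\mathrm{curl}_0;\Gamma_t,\Omega)$. Sliceable: $\Omega$ is sliceable (with respect to $\Gamma_t\neq\emptyset$) if there exist $J\in\mathbb N$ and $\Omega_j\subset\Omega$, $j=1,\dots,J$, such that $\Omega\setminus(\Omega_1\cup\dots\cup\Omega_J)$ is a null set and, for each $j$: the $\Omega_j$ are open, pairwise disjoint, simply connected Lipschitz subdomains of $\Omega$, and $\mathrm{int}_{\mathrm{rel}}(\overline{\Omega_j}\cap\Gamma_t)\neq\emptyset$ (interior relative to $\Gamma$). Maxwell constant $c_m>0$: $\|v\|_{L^2}\leq c_m(\|\mathrm{curl}\,v\|_{L^2}^2+\|\mathrm{div}\,v\|_{L^2}^2)^{1/2}$ for all $v\in\mathring H(\mathrm{curl};\Gamma_t,\Omega)\cap\mathring H(\mathrm{div};\Gamma_n,\Omega)\cap\mathcal H(\Omega)^\bot$. Irrotational Korn constant $c_k>0$: $\|T\|_{L^2}\leq c_k\|\mathrm{sym}\,T\|_{L^2}$ for all $T\in\mathring H(\mathrm{Curl}_0;\Gamma_t,\Omega)$. Such constants exist under the stated assumptions. *)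

theory Defs
  imports "HOL-Analysis.Analysis"
begin

subsection \<open>Smooth functions and classical differential operators\<close>

definition partial :: "3 \<Rightarrow> (real^3 \<Rightarrow> real) \<Rightarrow> real^3 \<Rightarrow> real" where
  "partial i f x = frechet_derivative f (at x) (axis i 1)"

primrec C_k :: "nat \<Rightarrow> (real^3 \<Rightarrow> real) \<Rightarrow> bool" where
  "C_k 0 f \<longleftrightarrow> continuous_on UNIV f"
| "C_k (Suc k) f \<longleftrightarrow> (\<forall>x. f differentiable (at x)) \<and> (\<forall>i. C_k k (partial i f))"

definition smooth :: "(real^3 \<Rightarrow> real) \<Rightarrow> bool" where
  "smooth f \<longleftrightarrow> (\<forall>k. C_k k f)"

definition gradient :: "(real^3 \<Rightarrow> real) \<Rightarrow> real^3 \<Rightarrow> real^3" where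
  "gradient f x = (\<chi> j. partial j f x)"

definition Jacobian :: "(real^3 \<Rightarrow> real^3) \<Rightarrow> real^3 \<Rightarrow> real^3^3" where
  "Jacobian v x = (\<chi> i. gradient (\<lambda>y. v y $ i) x)"

definition divergence :: "(real^3 \<Rightarrow> real^3) \<Rightarrow> real^3 \<Rightarrow> real" where
  "divergence v x = (\<Sum>i\<in>UNIV. partial i (\<lambda>y. v y $ i) x)"

definition curl :: "(real^3 \<Rightarrow> real^3) \<Rightarrow> real^3 \<Rightarrow> real^3" where
  "curl v x = vector
     [partial 2 (\<lambda>y. v y $ 3) x - partial 3 (\<lambda>y. v y $ 2) x,
      partial 3 (\<lambda>y. v y $ 1) x - partial 1 (\<lambda>y. v y $ 3) x,
      partial 1 (\<lambda>y. v y $ 2) x - partial 2 (\<lambda>y. v y $ 1) x]"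

definition sym_part :: "real^3^3 \<Rightarrow> real^3^3" where
  "sym_part T = (1/2) *\<^sub>R (T + transpose T)"

definition test_functions :: "(real^3) set \<Rightarrow> (real^3 \<Rightarrow> real) set" where
  "test_functions \<Omega> =
     {\<phi>. smooth \<phi> \<and> compact (closure {x. \<phi> x \<noteq> 0}) \<and> closure {x. \<phi> x \<noteq> 0} \<subseteq> \<Omega>}"

definition test_fields :: "(real^3) set \<Rightarrow> (real^3 \<Rightarrow> real^3) set" where
  "test_fields \<Omega> = {\<phi>. \<forall>i. (\<lambda>x. \<phi> x $ i) \<in> test_functions \<Omega>}"

text \<open>
  Elements of \<open>C\<^sup>\<infinity>\<close> on the closure of \<open>\<Omega>\<close> are represented by smooth extensions to the whole
  space. The condition that the support has positive distance to \<open>\<gamma>\<close> is written out, since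
  \<^const>\<open>setdist\<close> is \<open>0\<close> (instead of \<open>\<infinity>\<close>) if one of the sets is empty.
\<close>

definition smooth_away :: "(real^3) set \<Rightarrow> (real^3) set \<Rightarrow> (real^3 \<Rightarrow> real) set" where
  "smooth_away \<gamma> \<Omega> =
     {u. smooth u \<and>
         (\<exists>\<delta>>0. \<forall>x \<in> closure {x \<in> closure \<Omega>. u x \<noteq> 0}. \<forall>y\<in>\<gamma>. \<delta> \<le> dist x y)}"

definition smooth_fields_away :: "(real^3) set \<Rightarrow> (real^3) set \<Rightarrow> (real^3 \<Rightarrow> real^3) set" where
  "smooth_fields_away \<gamma> \<Omega> = {u. \<forall>i. (\<lambda>x. u x $ i) \<in> smooth_away \<gamma> \<Omega>}"

subsection \<open>Square-integrable fields and weak derivatives\<close>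

text \<open>
  Elements of \<open>L\<^sup>2\<close> are represented by functions, not by equivalence classes; all notions below
  are invariant under modification on null sets. On \<^typ>\<open>real^3^3\<close>, the library's inner product
  and norm are the Frobenius ones.
\<close>

definition L2 :: "(real^3) set \<Rightarrow> (real^3 \<Rightarrow> 'b::euclidean_space) set" where
  "L2 \<Omega> = {f. f \<in> borel_measurable (lebesgue_on \<Omega>) \<and>
              integrable (lebesgue_on \<Omega>) (\<lambda>x. (norm (f x))\<^sup>2)}"

definition L2_norm :: "(real^3) set \<Rightarrow> (real^3 \<Rightarrow> 'b::euclidean_space) \<Rightarrow> real" where
  "L2_norm \<Omega> f = sqrt (\<integral>x. (norm (f x))\<^sup>2 \<partial>(lebesgue_on \<Omega>))"

definition L2_inner ::
    "(real^3) set \<Rightarrow> (real^3 \<Rightarrow> 'b::euclidean_space) \<Rightarrow> (real^3 \<Rightarrow> 'b) \<Rightarrow> real" where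
  "L2_inner \<Omega> f g = (\<integral>x. f x \<bullet> g x \<partial>(lebesgue_on \<Omega>))"

definition orth_compl ::
    "(real^3) set \<Rightarrow> (real^3 \<Rightarrow> 'b::euclidean_space) set \<Rightarrow> (real^3 \<Rightarrow> 'b) set" where
  "orth_compl \<Omega> H = {v \<in> L2 \<Omega>. \<forall>h\<in>H. L2_inner \<Omega> v h = 0}"

text \<open>
  Each of the next three relations says that the first field and its weak derivative (the
  second field, unique up to null sets) both lie in \<open>L\<^sup>2\<close>.
\<close>

definition has_weak_curl ::
    "(real^3) set \<Rightarrow> (real^3 \<Rightarrow> real^3) \<Rightarrow> (real^3 \<Rightarrow> real^3) \<Rightarrow> bool" where
  "has_weak_curl \<Omega> v w \<longleftrightarrow> v \<in> L2 \<Omega> \<and> w \<in> L2 \<Omega> \<and>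
     (\<forall>\<phi> \<in> test_fields \<Omega>. L2_inner \<Omega> v (curl \<phi>) = L2_inner \<Omega> w \<phi>)"

definition has_weak_div ::
    "(real^3) set \<Rightarrow> (real^3 \<Rightarrow> real^3) \<Rightarrow> (real^3 \<Rightarrow> real) \<Rightarrow> bool" where
  "has_weak_div \<Omega> v d \<longleftrightarrow> v \<in> L2 \<Omega> \<and> d \<in> L2 \<Omega> \<and>
     (\<forall>\<phi> \<in> test_functions \<Omega>. L2_inner \<Omega> v (gradient \<phi>) = - L2_inner \<Omega> d \<phi>)"

definition has_weak_Grad ::
    "(real^3) set \<Rightarrow> (real^3 \<Rightarrow> real^3) \<Rightarrow> (real^3 \<Rightarrow> real^3^3) \<Rightarrow> bool" where
  "has_weak_Grad \<Omega> v G \<longleftrightarrow> v \<in> L2 \<Omega> \<and> G \<in> L2 \<Omega> \<and>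
     (\<forall>\<phi> \<in> test_functions \<Omega>. \<forall>i j.
        L2_inner \<Omega> (\<lambda>x. v x $ i) (partial j \<phi>) = - L2_inner \<Omega> (\<lambda>x. G x $ i $ j) \<phi>)"

definition H_Grad :: "(real^3) set \<Rightarrow> (real^3 \<Rightarrow> real^3) set" where
  "H_Grad \<Omega> = {v. \<exists>G. has_weak_Grad \<Omega> v G}"

definition Grad :: "(real^3) set \<Rightarrow> (real^3 \<Rightarrow> real^3) \<Rightarrow> real^3 \<Rightarrow> real^3^3" where
  "Grad \<Omega> v = (SOME G. has_weak_Grad \<Omega> v G)"

subsection \<open>Spaces with partial boundary conditions\<close>

definition H_curl_bc :: "(real^3) set \<Rightarrow> (real^3) set \<Rightarrow> (real^3 \<Rightarrow> real^3) set" where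
  "H_curl_bc \<gamma> \<Omega> = {v. \<exists>w. has_weak_curl \<Omega> v w \<and>
     (\<forall>\<epsilon>>0. \<exists>\<phi> \<in> smooth_fields_away \<gamma> \<Omega>.
        sqrt ((L2_norm \<Omega> (\<lambda>x. v x - \<phi> x))\<^sup>2 + (L2_norm \<Omega> (\<lambda>x. w x - curl \<phi> x))\<^sup>2) < \<epsilon>)}"

definition H_div_bc :: "(real^3) set \<Rightarrow> (real^3) set \<Rightarrow> (real^3 \<Rightarrow> real^3) set" where
  "H_div_bc \<gamma> \<Omega> = {v. \<exists>d. has_weak_div \<Omega> v d \<and>
     (\<forall>\<epsilon>>0. \<exists>\<phi> \<in> smooth_fields_away \<gamma> \<Omega>.
        sqrt ((L2_norm \<Omega> (\<lambda>x. v x - \<phi> x))\<^sup>2 + (L2_norm \<Omega> (\<lambda>x. d x - divergence \<phi> x))\<^sup>2) < \<epsilon>)}"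

definition H_Grad_bc :: "(real^3) set \<Rightarrow> (real^3) set \<Rightarrow> (real^3 \<Rightarrow> real^3) set" where
  "H_Grad_bc \<gamma> \<Omega> = {v \<in> H_Grad \<Omega>.
     \<forall>\<epsilon>>0. \<exists>\<phi> \<in> smooth_fields_away \<gamma> \<Omega>.
        sqrt ((L2_norm \<Omega> (\<lambda>x. v x - \<phi> x))\<^sup>2 + (L2_norm \<Omega> (\<lambda>x. Grad \<Omega> v x - Jacobian \<phi> x))\<^sup>2) < \<epsilon>}"

definition H_curl0_bc :: "(real^3) set \<Rightarrow> (real^3) set \<Rightarrow> (real^3 \<Rightarrow> real^3) set" where
  "H_curl0_bc \<gamma> \<Omega> = {v \<in> H_curl_bc \<gamma> \<Omega>. has_weak_curl \<Omega> v (\<lambda>x. 0)}"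

definition H_div0_bc :: "(real^3) set \<Rightarrow> (real^3) set \<Rightarrow> (real^3 \<Rightarrow> real^3) set" where
  "H_div0_bc \<gamma> \<Omega> = {v \<in> H_div_bc \<gamma> \<Omega>. has_weak_div \<Omega> v (\<lambda>x. 0)}"

definition H_Curl0_bc :: "(real^3) set \<Rightarrow> (real^3) set \<Rightarrow> (real^3 \<Rightarrow> real^3^3) set" where
  "H_Curl0_bc \<gamma> \<Omega> = {T. \<forall>i. (\<lambda>x. T x $ i) \<in> H_curl0_bc \<gamma> \<Omega>}"

definition harmonic_fields ::
    "(real^3) set \<Rightarrow> (real^3) set \<Rightarrow> (real^3) set \<Rightarrow> (real^3 \<Rightarrow> real^3) set" where
  "harmonic_fields \<Gamma>\<^sub>t \<Gamma>\<^sub>n \<Omega> = H_curl0_bc \<Gamma>\<^sub>t \<Omega> \<inter> H_div0_bc \<Gamma>\<^sub>n \<Omega>"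

definition maxwell_constant ::
    "(real^3) set \<Rightarrow> (real^3) set \<Rightarrow> (real^3) set \<Rightarrow> real \<Rightarrow> bool" where
  "maxwell_constant \<Gamma>\<^sub>t \<Gamma>\<^sub>n \<Omega> c \<longleftrightarrow> c > 0 \<and>
     (\<forall>v \<in> H_curl_bc \<Gamma>\<^sub>t \<Omega> \<inter> H_div_bc \<Gamma>\<^sub>n \<Omega> \<inter> orth_compl \<Omega> (harmonic_fields \<Gamma>\<^sub>t \<Gamma>\<^sub>n \<Omega>).
      \<forall>w d. has_weak_curl \<Omega> v w \<longrightarrow> has_weak_div \<Omega> v d \<longrightarrow>
        L2_norm \<Omega> v \<le> c * sqrt ((L2_norm \<Omega> w)\<^sup>2 + (L2_norm \<Omega> d)\<^sup>2))"

definition irrotational_korn_constant ::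
    "(real^3) set \<Rightarrow> (real^3) set \<Rightarrow> real \<Rightarrow> bool" where
  "irrotational_korn_constant \<Gamma>\<^sub>t \<Omega> c \<longleftrightarrow> c > 0 \<and>
     (\<forall>T \<in> H_Curl0_bc \<Gamma>\<^sub>t \<Omega>. L2_norm \<Omega> T \<le> c * L2_norm \<Omega> (\<lambda>x. sym_part (T x)))"

subsection \<open>Geometry of the domain and its boundary\<close>

definition is_domain :: "(real^3) set \<Rightarrow> bool" where
  "is_domain \<Omega> \<longleftrightarrow> open \<Omega> \<and> connected \<Omega> \<and> \<Omega> \<noteq> {}"

text \<open>
  Near each boundary point the set is, in suitable Cartesian coordinates, the strict epigraph of
  a Lipschitz function.
\<close>

definition lipschitz_boundary :: "(real^3) set \<Rightarrow> bool" where
  "lipschitz_boundary \<Omega> \<longleftrightarrow>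
     (\<forall>p \<in> frontier \<Omega>. \<exists>r>0. \<exists>(R :: real^3 \<Rightarrow> real^3) (g :: real \<times> real \<Rightarrow> real) L.
        orthogonal_transformation R \<and> L-lipschitz_on UNIV g \<and>
        \<Omega> \<inter> ball p r = {x \<in> ball p r. g (R x $ 1, R x $ 2) < R x $ 3})"

definition bilipschitz_chart ::
    "(real^3) set \<Rightarrow> (real^3) set \<Rightarrow> (real \<times> real) set \<Rightarrow> (real^3 \<Rightarrow> real \<times> real) \<Rightarrow> bool" where
  "bilipschitz_chart \<Gamma> U V \<Phi> \<longleftrightarrow>
     openin (top_of_set \<Gamma>) U \<and> open V \<and> bij_betw \<Phi> U V \<and>
     (\<exists>L. L-lipschitz_on U \<Phi>) \<and> (\<exists>L. L-lipschitz_on V (inv_into U \<Phi>))"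

definition separated_by_lipschitz_curve ::
    "(real^3) set \<Rightarrow> (real^3) set \<Rightarrow> (real^3) set \<Rightarrow> bool" where
  "separated_by_lipschitz_curve \<Gamma> \<Gamma>\<^sub>t \<Gamma>\<^sub>n \<longleftrightarrow>
     (let S = (top_of_set \<Gamma> frontier_of \<Gamma>\<^sub>t) \<inter> (top_of_set \<Gamma> frontier_of \<Gamma>\<^sub>n) in
      \<forall>p\<in>S. \<exists>U V \<Phi> (g :: real \<Rightarrow> real) L.
        p \<in> U \<and> bilipschitz_chart \<Gamma> U V \<Phi> \<and> L-lipschitz_on UNIV g \<and>
        \<Phi> ` (U \<inter> S) = {(s, t) \<in> V. t = g s} \<and>
        \<Phi> ` (U \<inter> \<Gamma>\<^sub>t) = {(s, t) \<in> V. g s < t} \<and>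
        \<Phi> ` (U \<inter> \<Gamma>\<^sub>n) = {(s, t) \<in> V. t < g s})"

definition sliceable :: "(real^3) set \<Rightarrow> (real^3) set \<Rightarrow> bool" where
  "sliceable \<Gamma>\<^sub>t \<Omega> \<longleftrightarrow>
     (\<exists>(J::nat) (\<Omega>' :: nat \<Rightarrow> (real^3) set).
        (\<Omega> - (\<Union>j\<in>{1..J}. \<Omega>' j)) \<in> null_sets lebesgue \<and>
        disjoint_family_on \<Omega>' {1..J} \<and>
        (\<forall>j\<in>{1..J}. \<Omega>' j \<subseteq> \<Omega> \<and> is_domain (\<Omega>' j) \<and> simply_connected (\<Omega>' j) \<and>
           lipschitz_boundary (\<Omega>' j) \<and>
           top_of_set (frontier \<Omega>) interior_of (closure (\<Omega>' j) \<inter> \<Gamma>\<^sub>t) \<noteq> {}))"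

end

theory Submission
  imports Defs
begin

text \<open>
  Since \<open>c\<^sub>k \<le> \<surd>2 c\<^sub>k\<close>, the irrotational Korn constant is dominated by \<open>c_hat\<close>, so only (iii) needs an
  argument: the Jacobian of a field in the \<open>H\<^sup>1\<close>-closure of the fields vanishing near \<open>\<Gamma>\<^sub>t\<close> is a
  tensor field to which (i) applies. Its rows are \<open>L\<^sup>2\<close>-limits of gradients of smooth
  functions vanishing near \<open>\<Gamma>\<^sub>t\<close>, and those gradients are curl free and again vanish near \<open>\<Gamma>\<^sub>t\<close>;
  that the rows are weakly curl free follows by testing the weak gradient with the first partial
  derivatives of a test field. Both facts rest on the symmetry of second derivatives.
\<close>

section \<open>Symmetry of second partial derivatives\<close>

lemma partial_has_real_derivative:
  assumes "\<And>y. f differentiable (at y)"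
  shows "((\<lambda>s. f (x + s *\<^sub>R axis i 1)) has_real_derivative
           partial i f (x + s *\<^sub>R axis i 1)) (at s within S)"
proof -
  let ?D = "frechet_derivative f (at (x + s *\<^sub>R axis i 1))"
  have D: "(f has_derivative ?D) (at (x + s *\<^sub>R axis i 1))"
    using assms frechet_derivative_works by blast
  have "((\<lambda>s. x + s *\<^sub>R axis i 1) has_derivative (\<lambda>h. h *\<^sub>R axis i 1)) (at s within S)"
    by (auto intro!: derivative_eq_intros)
  then have "((\<lambda>s. f (x + s *\<^sub>R axis i 1)) has_derivative (\<lambda>h. ?D (h *\<^sub>R axis i 1))) (at s within S)"
    by (rule has_derivative_compose) (rule D)
  moreover have "linear ?D"
    using D has_derivative_linear by blast
  ultimately show ?thesis
    by (simp add: has_field_derivative_def partial_def linear_cmul mult_commute_abs)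
qed

text \<open>Two applications of the mean value theorem: first in direction \<open>i\<close> to the
  increment of \<open>f\<close> along \<open>h *\<^sub>R axis j 1\<close>, then in direction
  \<open>j\<close> to \<open>partial i f\<close>. The second difference is symmetric in
  \<open>i\<close> and \<open>j\<close>, the right-hand side is not; this is what makes mixed
  partials comparable.\<close>

lemma second_difference_eq_mixed_partial:
  assumes f: "\<And>y. f differentiable (at y)"
    and fi: "\<And>y. partial i f differentiable (at y)"
    and "h > 0"
  shows "\<exists>s t. 0 < s \<and> s < h \<and> 0 < t \<and> t < h \<and>
    f (x + h *\<^sub>R axis i 1 + h *\<^sub>R axis j 1) - f (x + h *\<^sub>R axis i 1) - f (x + h *\<^sub>R axis j 1) + f x
      = h * (h * partial j (partial i f) (x + s *\<^sub>R axis i 1 + t *\<^sub>R axis j 1))"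
proof -
  let ?g = "\<lambda>s. f ((x + h *\<^sub>R axis j 1) + s *\<^sub>R axis i 1) - f (x + s *\<^sub>R axis i 1)"
  let ?g' = "\<lambda>s. partial i f ((x + h *\<^sub>R axis j 1) + s *\<^sub>R axis i 1) - partial i f (x + s *\<^sub>R axis i 1)"
  have "\<And>s. DERIV ?g s :> ?g' s"
    by (intro DERIV_diff partial_has_real_derivative f)
  then obtain s where s: "0 < s" "s < h" "?g h - ?g 0 = (h - 0) * ?g' s"
    using MVT2[OF \<open>h > 0\<close>, of ?g ?g'] by blast
  let ?k = "\<lambda>t. partial i f ((x + s *\<^sub>R axis i 1) + t *\<^sub>R axis j 1)"
  let ?k' = "\<lambda>t. partial j (partial i f) ((x + s *\<^sub>R axis i 1) + t *\<^sub>R axis j 1)"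
  have "\<And>t. DERIV ?k t :> ?k' t"
    by (intro partial_has_real_derivative fi)
  then obtain t where t: "0 < t" "t < h" "?k h - ?k 0 = (h - 0) * ?k' t"
    using MVT2[OF \<open>h > 0\<close>, of ?k ?k'] by blast
  have "?g' s = ?k h - ?k 0"
    by (simp add: ac_simps)
  with s t have "?g h - ?g 0 = h * (h * ?k' t)"
    by simp
  moreover have "?g h - ?g 0 = f (x + h *\<^sub>R axis i 1 + h *\<^sub>R axis j 1) - f (x + h *\<^sub>R axis i 1)
      - f (x + h *\<^sub>R axis j 1) + f x"
    by (simp add: ac_simps)
  ultimately show ?thesis
    using s t by metis
qed

text \<open>Schwarz's theorem. Expanding the same second difference in both orders shows that the
  two mixed partials agree at a pair of points near \<open>x\<close>; continuity at \<open>x\<close>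
  carries the equality to \<open>x\<close> itself.\<close>

lemma mixed_partials_commute:
  assumes f: "\<And>y. f differentiable (at y)"
    and fi: "\<And>y. partial i f differentiable (at y)"
    and fj: "\<And>y. partial j f differentiable (at y)"
    and ci: "isCont (partial j (partial i f)) x"
    and cj: "isCont (partial i (partial j f)) x"
  shows "partial j (partial i f) x = partial i (partial j f) x"
proof (rule ccontr)
  let ?a = "partial j (partial i f)" and ?b = "partial i (partial j f)"
  assume "?a x \<noteq> ?b x"
  \<comment> \<open>Half the gap: a common value within \<open>e\<close> of both \<open>?a x\<close>
    and \<open>?b x\<close> would make the gap smaller than itself.\<close>
  define e where "e = \<bar>?a x - ?b x\<bar> / 2"
  have "e > 0"
    using \<open>?a x \<noteq> ?b x\<close> by (simp add: e_def)
  obtain d1 where d1: "d1 > 0" "\<And>y. dist y x < d1 \<Longrightarrow> dist (?a y) (?a x) < e"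
    using ci \<open>e > 0\<close> unfolding continuous_at_eps_delta by blast
  obtain d2 where d2: "d2 > 0" "\<And>y. dist y x < d2 \<Longrightarrow> dist (?b y) (?b x) < e"
    using cj \<open>e > 0\<close> unfolding continuous_at_eps_delta by blast
  \<comment> \<open>The intermediate points are displaced from \<open>x\<close> by at most
    \<open>s + t < 2 * h\<close>, which must not exceed either radius.\<close>
  define h where "h = min d1 d2 / 2"
  have h: "h > 0" "2 * h \<le> d1" "2 * h \<le> d2"
    using d1(1) d2(1) by (auto simp: h_def)
  have near: "dist (x + s *\<^sub>R axis k 1 + t *\<^sub>R axis l 1) x < 2 * h"
    if "0 < s" "s < h" "0 < t" "t < h" for s t and k l :: 3
  proof -
    have "norm (s *\<^sub>R axis k 1 + t *\<^sub>R axis l (1::real)) \<le> s + t"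
      using norm_triangle_ineq[of "s *\<^sub>R axis k (1::real)" "t *\<^sub>R axis l 1"] that by simp
    with that show ?thesis
      by (simp add: dist_norm add.assoc)
  qed
  obtain s t where st: "0 < s" "s < h" "0 < t" "t < h"
    "f (x + h *\<^sub>R axis i 1 + h *\<^sub>R axis j 1) - f (x + h *\<^sub>R axis i 1) - f (x + h *\<^sub>R axis j 1) + f x
      = h * (h * ?a (x + s *\<^sub>R axis i 1 + t *\<^sub>R axis j 1))"
    using second_difference_eq_mixed_partial[OF f fi \<open>h > 0\<close>] by blast
  obtain s' t' where st': "0 < s'" "s' < h" "0 < t'" "t' < h"
    "f (x + h *\<^sub>R axis j 1 + h *\<^sub>R axis i 1) - f (x + h *\<^sub>R axis j 1) - f (x + h *\<^sub>R axis i 1) + f x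
      = h * (h * ?b (x + s' *\<^sub>R axis j 1 + t' *\<^sub>R axis i 1))"
    using second_difference_eq_mixed_partial[OF f fj \<open>h > 0\<close>] by blast
  have "x + h *\<^sub>R axis j 1 + h *\<^sub>R axis i 1 = x + h *\<^sub>R axis i 1 + h *\<^sub>R axis j 1"
    by (simp add: ac_simps)
  with st(5) st'(5) have
    "h * (h * ?a (x + s *\<^sub>R axis i 1 + t *\<^sub>R axis j 1)) =
     h * (h * ?b (x + s' *\<^sub>R axis j 1 + t' *\<^sub>R axis i 1))"
    by (simp only: diff_right_commute)
  then have eq: "?a (x + s *\<^sub>R axis i 1 + t *\<^sub>R axis j 1) = ?b (x + s' *\<^sub>R axis j 1 + t' *\<^sub>R axis i 1)"
    using h(1) by simp
  have "dist (?a (x + s *\<^sub>R axis i 1 + t *\<^sub>R axis j 1)) (?a x) < e"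
    using near[OF st(1-4)] h by (intro d1(2)) (rule less_le_trans)
  moreover have "dist (?b (x + s' *\<^sub>R axis j 1 + t' *\<^sub>R axis i 1)) (?b x) < e"
    using near[OF st'(1-4)] h by (intro d2(2)) (rule less_le_trans)
  ultimately show False
    unfolding eq dist_real_def e_def by (simp add: abs_if split: if_splits)
qed

section \<open>Smooth functions, supports and partial derivatives\<close>

lemma smooth_partial: "smooth f \<Longrightarrow> smooth (partial i f)"
  unfolding smooth_def by (metis C_k.simps(2))

lemma smooth_differentiable: "smooth f \<Longrightarrow> f differentiable (at x)"
  unfolding smooth_def by (metis C_k.simps(2))

lemma smooth_continuous_on: "smooth f \<Longrightarrow> continuous_on S f"
  unfolding smooth_def by (metis C_k.simps(1) continuous_on_subset subset_UNIV)

lemma smooth_partial_commute: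
  assumes "smooth f"
  shows "partial i (partial j f) = partial j (partial i f)"
proof
  fix x
  have "isCont (partial k (partial l f)) x" for k l
    using smooth_continuous_on[OF smooth_partial[OF smooth_partial[OF assms]], of UNIV]
    by (simp add: continuous_on_eq_continuous_at)
  then show "partial i (partial j f) x = partial j (partial i f) x"
    by (intro mixed_partials_commute smooth_differentiable smooth_partial assms)
qed

lemma curl_gradient: "smooth f \<Longrightarrow> curl (gradient f) x = 0"
  by (simp add: curl_def gradient_def smooth_partial_commute[of f 2 3]
      smooth_partial_commute[of f 3 1] smooth_partial_commute[of f 1 2]
      vec_eq_iff forall_3)

lemma partial_eq_0_outside_support:
  assumes "x \<notin> closure {x. f x \<noteq> 0}"
  shows "partial i f x = 0"
proof -
  have "((\<lambda>y. 0) has_derivative (\<lambda>h. 0)) (at x)"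
    by simp
  then have "(f has_derivative (\<lambda>h. 0)) (at x)"
  proof (rule has_derivative_transform_within_open)
    show "open (- closure {x. f x \<noteq> 0})" "x \<in> - closure {x. f x \<noteq> 0}"
      using assms by auto
    show "0 = f y" if "y \<in> - closure {x. f x \<noteq> 0}" for y
      using that closure_subset[of "{x. f x \<noteq> 0}"] by auto
  qed
  then show ?thesis
    by (simp add: partial_def frechet_derivative_at[symmetric])
qed

text \<open>Differentiation does not enlarge the support. This makes first derivatives of a test
  field admissible in the definition of the weak gradient.\<close>

lemma test_functions_partial:
  assumes "\<phi> \<in> test_functions \<Omega>"
  shows "partial i \<phi> \<in> test_functions \<Omega>"
proof -
  have "closure {x. partial i \<phi> x \<noteq> 0} \<subseteq> closure {x. \<phi> x \<noteq> 0}"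
    by (rule closure_minimal) (use partial_eq_0_outside_support in auto)
  with assms show ?thesis
    unfolding test_functions_def
    by (auto intro: smooth_partial bounded_subset simp: compact_eq_bounded_closed)
qed

text \<open>
  Outside the support of \<open>u\<close> in the closure of \<open>\<Omega>\<close>, the function may still be nonzero on the
  exterior of \<open>\<Omega>\<close>, so at boundary points the derivative is computed by approximation from inside.
\<close>

lemma smooth_away_partial:
  assumes "open \<Omega>" "u \<in> smooth_away \<gamma> \<Omega>"
  shows "partial i u \<in> smooth_away \<gamma> \<Omega>"
proof -
  let ?S = "closure {x \<in> closure \<Omega>. u x \<noteq> 0}"
  have u: "smooth u"
    using assms by (simp add: smooth_away_def)
  have inner: "partial i u y = 0" if "y \<in> \<Omega> - ?S" for y
  proof -
    have "((\<lambda>y. 0) has_derivative (\<lambda>h. 0)) (at y)"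
      by simp
    then have "(u has_derivative (\<lambda>h. 0)) (at y)"
    proof (rule has_derivative_transform_within_open)
      show "open (\<Omega> - ?S)" "y \<in> \<Omega> - ?S"
        using assms that by auto
      show "0 = u z" if "z \<in> \<Omega> - ?S" for z
        using that closure_subset[of "{x \<in> closure \<Omega>. u x \<noteq> 0}"] closure_subset[of \<Omega>] by auto
    qed
    then show ?thesis
      by (simp add: partial_def frechet_derivative_at[symmetric])
  qed
  have "partial i u x = 0" if "x \<in> closure \<Omega>" "x \<notin> ?S" for x
  proof -
    have "x \<in> closure (\<Omega> - ?S)"
      using open_Int_closure_subset[of "- ?S" \<Omega>] that by (auto simp: Diff_eq Int_commute)
    moreover have "continuous_on (closure (\<Omega> - ?S)) (partial i u)"
      by (intro smooth_continuous_on smooth_partial u)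
    ultimately show ?thesis
      using continuous_constant_on_closure[of "\<Omega> - ?S" "partial i u" 0 x] inner by blast
  qed
  \<comment> \<open>As the support does not grow, the distance \<open>\<delta>\<close> to
    \<open>\<gamma>\<close> that works for \<open>u\<close> also works for its derivative.\<close>
  then have "closure {x \<in> closure \<Omega>. partial i u x \<noteq> 0} \<subseteq> ?S"
    by (intro closure_minimal) auto
  then show ?thesis
    using assms smooth_partial[OF u] unfolding smooth_away_def by blast
qed

section \<open>Square-integrable fields\<close>

lemma L2_diff:
  assumes f: "f \<in> L2 \<Omega>" and g: "g \<in> L2 \<Omega>"
  shows "(\<lambda>x. f x - g x) \<in> L2 \<Omega>"
proof -
  have m: "f \<in> borel_measurable (lebesgue_on \<Omega>)" "g \<in> borel_measurable (lebesgue_on \<Omega>)"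
    and i: "integrable (lebesgue_on \<Omega>) (\<lambda>x. 2 * (norm (f x))\<^sup>2 + 2 * (norm (g x))\<^sup>2)"
    using f g by (auto simp: L2_def)
  have "(norm (f x - g x))\<^sup>2 \<le> 2 * (norm (f x))\<^sup>2 + 2 * (norm (g x))\<^sup>2" for x
  proof -
    have "(norm (f x - g x))\<^sup>2 \<le> (norm (f x) + norm (g x))\<^sup>2"
      by (intro power_mono norm_triangle_ineq4) simp
    also have "\<dots> \<le> 2 * (norm (f x))\<^sup>2 + 2 * (norm (g x))\<^sup>2"
      using zero_le_power2[of "norm (f x) - norm (g x)"]
      by (simp add: power2_eq_square algebra_simps)
    finally show ?thesis .
  qed
  then have "integrable (lebesgue_on \<Omega>) (\<lambda>x. (norm (f x - g x))\<^sup>2)"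
    using m by (intro Bochner_Integration.integrable_bound[OF i]) auto
  with m show ?thesis
    by (simp add: L2_def)
qed

lemma L2_nth:
  fixes f :: "real^3 \<Rightarrow> 'b::euclidean_space^'n"
  assumes "f \<in> L2 \<Omega>"
  shows "(\<lambda>x. f x $ i) \<in> L2 \<Omega>"
proof -
  have m: "f \<in> borel_measurable (lebesgue_on \<Omega>)"
    and int: "integrable (lebesgue_on \<Omega>) (\<lambda>x. (norm (f x))\<^sup>2)"
    using assms by (auto simp: L2_def)
  have mi: "(\<lambda>x. f x $ i) \<in> borel_measurable (lebesgue_on \<Omega>)"
    by (intro borel_measurable_continuous_on[OF _ m] continuous_intros)
  have "integrable (lebesgue_on \<Omega>) (\<lambda>x. (norm (f x $ i))\<^sup>2)"
    using mi by (intro Bochner_Integration.integrable_bound[OF int])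
      (auto intro!: power_mono Finite_Cartesian_Product.norm_nth_le)
  with mi show ?thesis
    by (simp add: L2_def)
qed

text \<open>Pointwise domination under the integral. Square-integrability of \<open>f\<close>
  matters: the integral of a nonintegrable function is 0 by convention, so the right-hand side could
  otherwise collapse.\<close>

lemma L2_norm_nth_le:
  fixes f :: "real^3 \<Rightarrow> 'b::euclidean_space^'n"
  assumes "f \<in> L2 \<Omega>"
  shows "L2_norm \<Omega> (\<lambda>x. f x $ i) \<le> L2_norm \<Omega> f"
  using assms L2_nth[OF assms, of i]
  unfolding L2_norm_def L2_def
  by (auto intro!: integral_mono power_mono Finite_Cartesian_Product.norm_nth_le)

lemma L2_0: "(\<lambda>x. 0) \<in> L2 \<Omega>"
  by (simp add: L2_def)

text \<open>A bounded open set has finite measure, and a continuous function is bounded on its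
  compact closure. This covers Jacobians of approximating fields, which need not have compact
  support in \<open>\<Omega>\<close>.\<close>

lemma L2_continuous:
  assumes "bounded \<Omega>" "open \<Omega>" "continuous_on UNIV f"
  shows "f \<in> L2 \<Omega>"
proof -
  have lm: "\<Omega> \<in> lmeasurable"
    using assms by (simp add: lmeasurable_open)
  then interpret finite_measure "lebesgue_on \<Omega>"
    by (rule finite_measure_lebesgue_on)
  have m: "f \<in> borel_measurable (lebesgue_on \<Omega>)"
    using assms lm continuous_on_subset
    by (intro continuous_imp_measurable_on_sets_lebesgue) auto
  have "bounded (f ` closure \<Omega>)"
    using assms
    by (intro compact_imp_bounded compact_continuous_image) (auto intro: continuous_on_subset)
  then obtain B where B: "\<And>x. x \<in> \<Omega> \<Longrightarrow> norm (f x) \<le> B"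
    using closure_subset[of \<Omega>] unfolding bounded_iff by blast
  have "integrable (lebesgue_on \<Omega>) (\<lambda>x. (norm (f x))\<^sup>2)"
    using m B by (intro integrable_const_bound[of _ "B\<^sup>2"]) (auto intro!: AE_I2 power_mono)
  with m show ?thesis
    by (simp add: L2_def)
qed

text \<open>Follows from \<open>2 * \<bar>a * b\<bar> \<le> a^2 + b^2\<close>; it permits splitting
  an inner product with a curl into separate integrals.\<close>

lemma L2_mult_integrable:
  fixes f g :: "real^3 \<Rightarrow> real"
  assumes "f \<in> L2 \<Omega>" "g \<in> L2 \<Omega>"
  shows "integrable (lebesgue_on \<Omega>) (\<lambda>x. f x * g x)"
proof -
  have m: "f \<in> borel_measurable (lebesgue_on \<Omega>)" "g \<in> borel_measurable (lebesgue_on \<Omega>)"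
    and i: "integrable (lebesgue_on \<Omega>) (\<lambda>x. (f x)\<^sup>2 + (g x)\<^sup>2)"
    using assms by (auto simp: L2_def)
  have "\<bar>f x * g x\<bar> \<le> (f x)\<^sup>2 + (g x)\<^sup>2" for x
  proof -
    have "2 * \<bar>f x * g x\<bar> \<le> (f x)\<^sup>2 + (g x)\<^sup>2"
      using zero_le_power2[of "\<bar>f x\<bar> - \<bar>g x\<bar>"]
      unfolding power2_diff by (simp add: abs_mult)
    moreover have "0 \<le> \<bar>f x * g x\<bar>"
      by (rule abs_ge_zero)
    ultimately show ?thesis
      by linarith
  qed
  then show ?thesis
    using m by (intro Bochner_Integration.integrable_bound[OF i]) auto
qed

section \<open>Weak gradients as irrotational tensor fields\<close>

lemma has_weak_curl_row_of_weak_Grad: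
  assumes "bounded \<Omega>" "open \<Omega>" "has_weak_Grad \<Omega> v G"
  shows "has_weak_curl \<Omega> (\<lambda>x. G x $ i) (\<lambda>x. 0)"
  unfolding has_weak_curl_def
proof (intro conjI ballI)
  have G: "G \<in> L2 \<Omega>"
    using assms by (simp add: has_weak_Grad_def)
  show "(\<lambda>x. G x $ i) \<in> L2 \<Omega>" "(\<lambda>x. 0) \<in> L2 \<Omega>"
    using L2_nth[OF G] L2_0 by auto
  fix \<phi> assume \<phi>: "\<phi> \<in> test_fields \<Omega>"
  define p where "p l k = partial k (\<lambda>x. \<phi> x $ l)" for l k
  have \<phi>_test: "(\<lambda>x. \<phi> x $ l) \<in> test_functions \<Omega>" for l
    using \<phi> by (simp add: test_fields_def)
  then have \<phi>_smooth: "smooth (\<lambda>x. \<phi> x $ l)" for l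
    by (simp add: test_functions_def)
  have p_test: "p l k \<in> test_functions \<Omega>" for l k
    unfolding p_def by (rule test_functions_partial[OF \<phi>_test])
  have weak: "L2_inner \<Omega> (\<lambda>x. v x $ i) (partial j (p l k)) = - L2_inner \<Omega> (\<lambda>x. G x $ i $ j) (p l k)"
    for j k l
    using assms(3) p_test[of l k] unfolding has_weak_Grad_def by blast
  define I where "I j l k = (\<integral>x. G x $ i $ j * p l k x \<partial>lebesgue_on \<Omega>)" for j l k
  \<comment> \<open>Both sides equal minus the integral of \<open>v x $ i\<close> against the second
    derivative of component \<open>l\<close> of \<open>\<phi>\<close> in directions \<open>j\<close>
    and \<open>k\<close>, whose order is immaterial.\<close>
  have swap: "I j l k = I k l j" for j k l
    using weak[of j l k] weak[of k l j] smooth_partial_commute[OF \<phi>_smooth[of l], of j k]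
    by (simp add: I_def L2_inner_def p_def)
  have p_L2: "p l k \<in> L2 \<Omega>" for l k
    unfolding p_def
    by (intro L2_continuous assms(1,2) smooth_continuous_on smooth_partial \<phi>_smooth)
  have int: "integrable (lebesgue_on \<Omega>) (\<lambda>x. G x $ i $ j * p l k x)" for j l k
    by (intro L2_mult_integrable p_L2 L2_nth G)
  have "G x $ i \<bullet> curl \<phi> x =
      (G x $ i $ 1 * p 3 2 x - G x $ i $ 1 * p 2 3 x) +
      (G x $ i $ 2 * p 1 3 x - G x $ i $ 2 * p 3 1 x) +
      (G x $ i $ 3 * p 2 1 x - G x $ i $ 3 * p 1 2 x)" for x
    by (simp add: curl_def p_def inner_vec_def sum_3 algebra_simps)
  then have "L2_inner \<Omega> (\<lambda>x. G x $ i) (curl \<phi>) =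
      (I 1 3 2 - I 1 2 3) + (I 2 1 3 - I 2 3 1) + (I 3 2 1 - I 3 1 2)"
    by (simp add: L2_inner_def I_def int)
  \<comment> \<open>The six terms cancel in pairs sharing the middle index, that is, the same
    component of \<open>\<phi>\<close>.\<close>
  also have "\<dots> = 0"
    using swap[of 1 3 2] swap[of 1 2 3] swap[of 2 1 3] by simp
  finally show "L2_inner \<Omega> (\<lambda>x. G x $ i) (curl \<phi>) = L2_inner \<Omega> (\<lambda>x. 0) \<phi>"
    by (simp add: L2_inner_def)
qed

text \<open>Row \<open>i\<close> of the weak gradient is approximated by row \<open>i\<close> of the
  Jacobians of the fields approximating \<open>v\<close>. These rows are classical gradients, so the
  curl part of the graph norm vanishes and only the \<open>L2\<close> distance of the rows
  remains.\<close>

lemma Grad_in_H_Curl0_bc: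
  assumes "bounded \<Omega>" "open \<Omega>" "v \<in> H_Grad_bc \<gamma> \<Omega>"
  shows "Grad \<Omega> v \<in> H_Curl0_bc \<gamma> \<Omega>"
proof -
  \<comment> \<open>\<open>Grad\<close> is a choice, so a weak gradient must exist before the chosen
    one is known to be one.\<close>
  obtain G' where "has_weak_Grad \<Omega> v G'"
    using assms(3) by (auto simp: H_Grad_bc_def H_Grad_def)
  then have G: "has_weak_Grad \<Omega> v (Grad \<Omega> v)"
    unfolding Grad_def by (rule someI[where P = "has_weak_Grad \<Omega> v"])
  then have G_L2: "Grad \<Omega> v \<in> L2 \<Omega>"
    by (simp add: has_weak_Grad_def)
  have "(\<lambda>x. Grad \<Omega> v x $ i) \<in> H_curl0_bc \<gamma> \<Omega>" for i
  proof -
    have curl0: "has_weak_curl \<Omega> (\<lambda>x. Grad \<Omega> v x $ i) (\<lambda>x. 0)"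
      by (rule has_weak_curl_row_of_weak_Grad[OF assms(1,2) G])
    have "\<exists>\<psi> \<in> smooth_fields_away \<gamma> \<Omega>.
        sqrt ((L2_norm \<Omega> (\<lambda>x. Grad \<Omega> v x $ i - \<psi> x))\<^sup>2 + (L2_norm \<Omega> (\<lambda>x. 0 - curl \<psi> x))\<^sup>2) < \<epsilon>"
      if "\<epsilon> > 0" for \<epsilon>
    proof -
      obtain \<phi> where \<phi>: "\<phi> \<in> smooth_fields_away \<gamma> \<Omega>"
        and less: "sqrt ((L2_norm \<Omega> (\<lambda>x. v x - \<phi> x))\<^sup>2
          + (L2_norm \<Omega> (\<lambda>x. Grad \<Omega> v x - Jacobian \<phi> x))\<^sup>2) < \<epsilon>"
        using assms(3) \<open>\<epsilon> > 0\<close> unfolding H_Grad_bc_def by blast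
      define \<psi> where "\<psi> = gradient (\<lambda>x. \<phi> x $ i)"
      have away: "(\<lambda>x. \<phi> x $ k) \<in> smooth_away \<gamma> \<Omega>" for k
        using \<phi> by (simp add: smooth_fields_away_def)
      then have \<phi>_smooth: "smooth (\<lambda>x. \<phi> x $ k)" for k
        by (simp add: smooth_away_def)
      have \<psi>_away: "\<psi> \<in> smooth_fields_away \<gamma> \<Omega>"
        using smooth_away_partial[OF assms(2) away]
        by (simp add: smooth_fields_away_def \<psi>_def gradient_def)
      have "continuous_on UNIV (Jacobian \<phi>)"
        unfolding Jacobian_def gradient_def
        by (intro continuous_on_vec_lambda smooth_continuous_on smooth_partial \<phi>_smooth)
      then have "(\<lambda>x. Grad \<Omega> v x - Jacobian \<phi> x) \<in> L2 \<Omega>"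
        by (intro L2_diff G_L2 L2_continuous assms(1,2))
      from L2_norm_nth_le[OF this, of i]
      have "L2_norm \<Omega> (\<lambda>x. Grad \<Omega> v x $ i - \<psi> x) \<le> L2_norm \<Omega> (\<lambda>x. Grad \<Omega> v x - Jacobian \<phi> x)"
        by (simp add: Jacobian_def \<psi>_def)
      \<comment> \<open>The distance of the Jacobians is one leg of the graph norm distance, hence
        bounded by it.\<close>
      also have "\<dots> < \<epsilon>"
        using real_sqrt_sum_squares_ge2 less by (rule le_less_trans)
      finally have "L2_norm \<Omega> (\<lambda>x. Grad \<Omega> v x $ i - \<psi> x) < \<epsilon>" .
      moreover have "L2_norm \<Omega> (\<lambda>x. 0 - curl \<psi> x) = 0"
        by (simp add: L2_norm_def \<psi>_def curl_gradient[OF \<phi>_smooth])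
      moreover have "0 \<le> L2_norm \<Omega> (\<lambda>x. Grad \<Omega> v x $ i - \<psi> x)"
        by (simp add: L2_norm_def)
      ultimately show ?thesis
        using \<psi>_away by (intro bexI[of _ \<psi>]) auto
    qed
    with curl0 show ?thesis
      unfolding H_curl0_bc_def H_curl_bc_def by blast
  qed
  then show ?thesis
    by (simp add: H_Curl0_bc_def)
qed

theorem corollary16:
  fixes \<Omega> \<Gamma> \<Gamma>\<^sub>t \<Gamma>\<^sub>n :: "(real^3) set" and c\<^sub>m c\<^sub>k c_hat :: real
  assumes "is_domain \<Omega>" and "bounded \<Omega>" and "sliceable \<Gamma>\<^sub>t \<Omega>"
    and "\<Gamma> = frontier \<Omega>" and "lipschitz_boundary \<Omega>"
    and "\<Gamma>\<^sub>t \<noteq> {}" and "openin (top_of_set \<Gamma>) \<Gamma>\<^sub>t"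
    and "\<Gamma>\<^sub>n = \<Gamma> - closure \<Gamma>\<^sub>t" and "separated_by_lipschitz_curve \<Gamma> \<Gamma>\<^sub>t \<Gamma>\<^sub>n"
    and "maxwell_constant \<Gamma>\<^sub>t \<Gamma>\<^sub>n \<Omega> c\<^sub>m"
    and "irrotational_korn_constant \<Gamma>\<^sub>t \<Omega> c\<^sub>k"
    and "c_hat = max (sqrt 2 * c\<^sub>k) (c\<^sub>m * sqrt (1 + 2 * c\<^sub>k\<^sup>2))"
  shows "(\<forall>T \<in> H_Curl0_bc \<Gamma>\<^sub>t \<Omega>.
            L2_norm \<Omega> T \<le> c_hat * L2_norm \<Omega> (\<lambda>x. sym_part (T x))) \<and>
         (\<forall>v \<in> H_Grad \<Omega>. Grad \<Omega> v \<in> H_Curl0_bc \<Gamma>\<^sub>t \<Omega> \<longrightarrow>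
            L2_norm \<Omega> (Grad \<Omega> v) \<le> c_hat * L2_norm \<Omega> (\<lambda>x. sym_part (Grad \<Omega> v x))) \<and>
         (\<forall>v \<in> H_Grad_bc \<Gamma>\<^sub>t \<Omega>.
            L2_norm \<Omega> (Grad \<Omega> v) \<le> c_hat * L2_norm \<Omega> (\<lambda>x. sym_part (Grad \<Omega> v x)))"
proof -
  have "c\<^sub>k > 0"
    using assms by (simp add: irrotational_korn_constant_def)
  then have "c\<^sub>k \<le> sqrt 2 * c\<^sub>k"
    by simp
  then have "c\<^sub>k \<le> c_hat"
    using assms by simp
  have korn: "L2_norm \<Omega> T \<le> c_hat * L2_norm \<Omega> (\<lambda>x. sym_part (T x))"
    if "T \<in> H_Curl0_bc \<Gamma>\<^sub>t \<Omega>" for T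
  proof -
    have "L2_norm \<Omega> T \<le> c\<^sub>k * L2_norm \<Omega> (\<lambda>x. sym_part (T x))"
      using assms that by (simp add: irrotational_korn_constant_def)
    also have "\<dots> \<le> c_hat * L2_norm \<Omega> (\<lambda>x. sym_part (T x))"
      using \<open>c\<^sub>k \<le> c_hat\<close> by (intro mult_right_mono) (simp_all add: L2_norm_def)
    finally show ?thesis .
  qed
  have "open \<Omega>"
    using assms by (simp add: is_domain_def)
  \<comment> \<open>Part (i) is \<open>korn\<close>, part (ii) is its instance
    \<open>T = Grad \<Omega> v\<close>, and in part (iii) the closure lemma places
    \<open>Grad \<Omega> v\<close> in the space where \<open>korn\<close> applies.\<close>
  with korn \<open>bounded \<Omega>\<close> show ?thesis
    using Grad_in_H_Curl0_bc by blast
qed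

end
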